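(* Let $c>0$ and let $[\omega_{\min},\omega_{\max}]$ be a frequency interval with $\omega_{\min}<\omega_{\max}$. For an admissible source $(D,S,t_0)$ (see context), both the convex hull $\mathrm{ch}(D)$ and $t_0$ are uniquely determined by the multi-frequency far-field patterns $\{u^\infty(\hat x,\omega):\omega\in[\omega_{\min},\omega_{\max}],\ \hat x\in\mathbb{S}^2\}$. That is, if $(D,S,t_0)$ and $(D',S',t_0')$ are two admissible sources whose far-field patterns coincide for all $\hat x\in\mathbb{S}^2$ and all $\omega\in[\omega_{\min},\omega_{\max}]$, then $\mathrm{ch}(D)=\mathrm{ch}(D')$ and $t_0=t_0'$.
   Context: An admissible source $(D,S,t_0)$ consists of $t_0>0$, a bounded Lipschitz domain $D\subset\mathbb{R}^3$ with $\mathbb{R}^3\setminus\overline D$ connected, and a real-valued $S\in C(\overline D)$ with $\mathrm{supp}(S)=\overline D\subset B_R=\{x\in\mathbb{R}^3:|x|<R\}$ for some $R>0$ and $|S(x)|>0$ for a.e. $x\in\overline D$. (Here $S(x)=S_0(x-a(t_0))$ is the source profile emitted at the single instant $t_0$ by a source moving along a continuous trajectory $a:[0,T]\to\mathbb{R}^3$ with $|a'(t)|<c$; only $S$ enters the far-field pattern.) Its far-field pattern is $$u^\infty(\hat x,\omega)=\frac{1}{\sqrt{2\pi}}\int_D e^{-i\omega(c^{-1}\hat x\cdot y-t_0)}S(y)\,dy,\qquad \hat x\in\mathbb{S}^2 .$$ $\mathrm{ch}(D)$ is the convex hull of $D$, that is, the intersection of all half-spaces containing $D$. *)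

theory Defs
  imports "HOL-Analysis.Analysis"
begin

text \<open>
  A Lipschitz domain: after an orthogonal change of coordinates \<^term>\<open>Q\<close>, near each boundary
  point the set is the strict epigraph of a Lipschitz function of the first two coordinates.
  Taking \<^term>\<open>\<phi>\<close> on the whole plane is no restriction (Lipschitz extension), and a translation
  of the coordinates can be absorbed into \<^term>\<open>\<phi>\<close>.  Openness of \<^term>\<open>D\<close> forces the boundary
  inside \<^term>\<open>U\<close> to be the graph itself.
\<close>

definition lipschitz_domain :: "(real^3) set \<Rightarrow> bool" where
  "lipschitz_domain D \<longleftrightarrow>
     open D \<and> connected D \<and> D \<noteq> {} \<and>
     (\<forall>p \<in> frontier D. \<exists>U (Q :: real^3 \<Rightarrow> real^3) (\<phi> :: real^2 \<Rightarrow> real) L.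
        open U \<and> p \<in> U \<and> orthogonal_transformation Q \<and> L-lipschitz_on UNIV \<phi> \<and>
        D \<inter> U = {x \<in> U. Q x $ 3 > \<phi> (vector [Q x $ 1, Q x $ 2])})"

text \<open>
  The profile is a function on \<^term>\<open>closure D\<close> only: the values of \<^term>\<open>S\<close> elsewhere are
  irrelevant, so the support is the closure of the set of points of \<^term>\<open>closure D\<close> at which
  \<^term>\<open>S\<close> does not vanish.
\<close>

definition admissible_source :: "(real^3) set \<Rightarrow> (real^3 \<Rightarrow> real) \<Rightarrow> real \<Rightarrow> bool" where
  "admissible_source D S t0 \<longleftrightarrow>
     t0 > 0 \<and>
     bounded D \<and> lipschitz_domain D \<and> connected (- closure D) \<and>
     continuous_on (closure D) S \<and>
     closure {x \<in> closure D. S x \<noteq> 0} = closure D \<and>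
     (\<exists>R>0. closure D \<subseteq> ball 0 R) \<and>
     (AE x in lborel. x \<in> closure D \<longrightarrow> \<bar>S x\<bar> > 0)"

definition far_field ::
    "real \<Rightarrow> (real^3) set \<Rightarrow> (real^3 \<Rightarrow> real) \<Rightarrow> real \<Rightarrow> real^3 \<Rightarrow> real \<Rightarrow> complex" where
  "far_field c D S t0 xhat \<omega> =
     complex_of_real (1 / sqrt (2 * pi)) *
     (LINT y:D|lborel.
        exp (- (\<i> * complex_of_real (\<omega> * (inverse c * (xhat \<bullet> y) - t0)))) * complex_of_real (S y))"

text \<open>
  For open sets the algebraic convex hull is the intersection of all half-spaces (open or closed)
  containing the set; with closed half-spaces only, one obtains its closure.
\<close>

lemma convex_hull_open_eq_Inter_halfspaces:
  fixes D :: "'a::euclidean_space set"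
  assumes "open D" "D \<noteq> {}"
  shows "convex hull D = \<Inter>{H. D \<subseteq> H \<and> (\<exists>a b. a \<noteq> 0 \<and> (H = {x. a \<bullet> x < b} \<or> H = {x. a \<bullet> x \<le> b}))}"
    (is "_ = \<Inter>?F")
proof (intro equalityI subsetI)
  fix x assume x: "x \<in> convex hull D"
  show "x \<in> \<Inter>?F"
  proof
    fix H assume "H \<in> ?F"
    then have "D \<subseteq> H" "convex H"
      by (auto simp: convex_halfspace_lt convex_halfspace_le)
    then have "convex hull D \<subseteq> H" by (rule hull_minimal)
    with x show "x \<in> H" by (rule rev_subsetD)
  qed
next
  fix x assume x: "x \<in> \<Inter>?F"
  show "x \<in> convex hull D"
  proof (rule ccontr)
    assume nx: "x \<notin> convex hull D"
    have ne: "convex hull D \<noteq> {}" using assms by simp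
    obtain a b where a: "a \<noteq> 0" and ab: "\<forall>y\<in>convex hull D. a \<bullet> y \<le> b" "\<forall>y\<in>{x}. a \<bullet> y \<ge> b"
    proof -
      have "convex hull D \<inter> {x} = {}" using nx by simp
      from separating_hyperplane_sets[OF convex_convex_hull convex_singleton ne insert_not_empty this]
      show ?thesis using that by blast
    qed
    have "a \<bullet> y < b" if y: "y \<in> D" for y
    proof -
      obtain e where e: "e > 0" "cball y e \<subseteq> D" using assms(1) y open_contains_cball by blast
      define z where "z = y + (e / norm a) *\<^sub>R a"
      have "z \<in> cball y e" using e a by (simp add: z_def dist_norm)
      then have "a \<bullet> z \<le> b" using e ab(1) hull_inc[of z D convex] by blast
      moreover have "a \<bullet> z = a \<bullet> y + (e / norm a) * (a \<bullet> a)"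
        by (simp add: z_def inner_add_right)
      moreover have "(e / norm a) * (a \<bullet> a) > 0" using e a by simp
      ultimately show ?thesis by linarith
    qed
    then have "D \<subseteq> {y. a \<bullet> y < b}" by blast
    with a have "{y. a \<bullet> y < b} \<in> ?F" by blast
    with x have "x \<in> {y. a \<bullet> y < b}" by (rule InterD)
    then show False using ab(2) by simp
  qed
qed

lemma closure_convex_hull_eq_Inter_closed_halfspaces:
  fixes D :: "'a::euclidean_space set"
  shows "closure (convex hull D) = \<Inter>{H. D \<subseteq> H \<and> (\<exists>a b. a \<noteq> 0 \<and> H = {x. a \<bullet> x \<le> b})}"
    (is "_ = \<Inter>?F")
proof (intro equalityI subsetI)
  fix x assume x: "x \<in> closure (convex hull D)"
  show "x \<in> \<Inter>?F"
  proof
    fix H assume "H \<in> ?F"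
    then have "D \<subseteq> H" "convex H" "closed H"
      by (auto simp: convex_halfspace_le closed_halfspace_le)
    then have "closure (convex hull D) \<subseteq> H"
      by (intro closure_minimal hull_minimal)
    with x show "x \<in> H" by (rule rev_subsetD)
  qed
next
  fix x assume x: "x \<in> \<Inter>?F"
  show "x \<in> closure (convex hull D)"
  proof (rule ccontr)
    assume nx: "x \<notin> closure (convex hull D)"
    obtain a b where ab: "a \<bullet> x < b" "\<forall>y\<in>closure (convex hull D). a \<bullet> y > b"
      using separating_hyperplane_closed_point[OF convex_closure[OF convex_convex_hull] closed_closure nx] by blast
    have sub: "D \<subseteq> closure (convex hull D)"
      using hull_subset closure_subset by (rule order_trans)
    show False
    proof (cases "a = 0")
      case True
      have "D = {}"
      proof (rule equals0I)
        fix y assume "y \<in> D"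
        with sub ab(2) have "a \<bullet> y > b" by blast
        with True ab(1) show False by simp
      qed
      define v :: 'a where "v = (SOME i. i \<in> Basis)"
      have "v \<noteq> 0" unfolding v_def by (rule nonzero_Basis[OF SOME_Basis])
      with \<open>D = {}\<close> have "{y. v \<bullet> y \<le> v \<bullet> x - 1} \<in> ?F" by blast
      with x have "x \<in> {y. v \<bullet> y \<le> v \<bullet> x - 1}" by (rule InterD)
      then show False by simp
    next
      case False
      have "D \<subseteq> {y. (- a) \<bullet> y \<le> - b}"
      proof
        fix y assume "y \<in> D"
        with sub ab(2) have "a \<bullet> y > b" by blast
        then show "y \<in> {y. (- a) \<bullet> y \<le> - b}" by simp
      qed
      moreover have "- a \<noteq> 0" using False by simp
      ultimately have "{y. (- a) \<bullet> y \<le> - b} \<in> ?F" by blast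
      with x have "x \<in> {y. (- a) \<bullet> y \<le> - b}" by (rule InterD)
      then show False using ab(1) by simp
    qed
  qed
qed

end

theory Submission
  imports Defs "HOL-Complex_Analysis.Cauchy_Integral_Formula"
begin

text \<open>
  Up to a constant factor the far field at direction \<open>x\<close> and frequency \<open>\<omega>\<close> is
  \<open>e\<^sup>i\<^sup>\<omega>\<^sup>t F(\<omega> x / c)\<close>, where \<open>t\<close> is the emission time and \<open>F\<close> the Fourier transform of
  \<open>S\<close> extended by zero.  It is entire in \<open>\<omega>\<close>, so agreement on the band gives agreement
  at all real frequencies.  The arguments \<open>(x, \<omega>)\<close> and \<open>(-x, -\<omega>)\<close> see the same value of \<open>F\<close>
  but opposite time phases; comparing both forces \<open>e\<^sup>2\<^sup>i\<^sup>\<omega>\<^sup>(\<^sup>t\<^sup>-\<^sup>t\<^sup>'\<^sup>) = 1\<close> wherever \<open>F \<noteq> 0\<close>,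
  hence \<open>t = t'\<close>, and then \<open>F = F'\<close>.  Fourier uniqueness shows that the extended profiles agree,
  so \<open>D\<close> and \<open>D'\<close> have the same closure, and an open convex set is determined by its closure.
\<close>

section \<open>Exponential integrals as entire functions of a complex frequency\<close>

text \<open>Since \<open>p\<close> is bounded where \<open>f\<close> lives, the terms of the
  exponential series are dominated by a summable multiple of \<open>norm (f x)\<close>, so sum and
  integral commute. \<open>\<bar>B\<bar>\<close> allows for a negative \<open>B\<close>, which can
  occur only when \<open>f\<close> is zero.\<close>

lemma integral_exp_sums:
  fixes p f :: "'a \<Rightarrow> complex"
  assumes f: "integrable M f" and p [measurable]: "p \<in> borel_measurable M"
    and B: "\<And>x. f x \<noteq> 0 \<Longrightarrow> norm (p x) \<le> B"
  shows "integrable M (\<lambda>x. exp (z * p x) * f x)"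
    and "(\<lambda>n. (LINT x|M. p x ^ n / fact n * f x) * z ^ n) sums (LINT x|M. exp (z * p x) * f x)"
proof -
  note [measurable] = borel_measurable_integrable[OF f]
  define g where "g n x = (z * p x) ^ n /\<^sub>R fact n * f x" for n x
  have bd: "norm (g n x) \<le> (norm z * \<bar>B\<bar>) ^ n / fact n * norm (f x)" for n x
  proof (cases "f x = 0")
    case False
    then have "norm (p x) \<le> \<bar>B\<bar>" using B[of x] by linarith
    then have "norm (z * p x) ^ n \<le> (norm z * \<bar>B\<bar>) ^ n"
      by (intro power_mono) (auto simp: norm_mult mult_left_mono)
    then show ?thesis
      by (auto simp: g_def norm_mult norm_power divide_simps intro!: mult_right_mono)
  qed (simp add: g_def)
  have [measurable]: "g n \<in> borel_measurable M" for n unfolding g_def by measurable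
  have int_g: "integrable M (g n)" for n
  proof (rule Bochner_Integration.integrable_bound)
    show "integrable M (\<lambda>x. (norm z * \<bar>B\<bar>) ^ n / fact n * norm (f x))"
      using f by (intro integrable_mult_right integrable_norm)
    show "AE x in M. norm (g n x) \<le> norm ((norm z * \<bar>B\<bar>) ^ n / fact n * norm (f x))"
      using bd by (intro AE_I2 order_trans[OF bd]) simp
  qed simp
  have sm: "summable (\<lambda>n. (norm z * \<bar>B\<bar>) ^ n / fact n * c)" for c :: real
    using summable_mult2[OF summable_exp[of "norm z * \<bar>B\<bar>"], of c]
    by (simp add: divide_inverse mult_ac)
  have sums_g: "(\<lambda>n. g n x) sums (exp (z * p x) * f x)" for x
    unfolding g_def by (intro sums_mult2 exp_converges)
  have s1: "AE x in M. summable (\<lambda>n. norm (g n x))"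
    using bd by (intro AE_I2 summable_comparison_test'[OF sm]) auto
  have s2: "summable (\<lambda>n. LINT x|M. norm (g n x))"
  proof (rule summable_comparison_test'[OF sm])
    fix n :: nat
    have "(LINT x|M. norm (g n x)) \<le> (LINT x|M. (norm z * \<bar>B\<bar>) ^ n / fact n * norm (f x))"
      using int_g f bd by (intro integral_mono integrable_norm integrable_mult_right) auto
    then show "norm (LINT x|M. norm (g n x)) \<le> (norm z * \<bar>B\<bar>) ^ n / fact n * (LINT x|M. norm (f x))"
      by simp
  qed
  have eq: "(\<Sum>n. g n x) = exp (z * p x) * f x" for x using sums_g by (rule sums_unique[symmetric])
  show "integrable M (\<lambda>x. exp (z * p x) * f x)"
    using integrable_suminf[OF int_g s1 s2] by (simp add: eq)
  have "(LINT x|M. g n x) = (LINT x|M. p x ^ n / fact n * f x) * z ^ n" for n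
    unfolding integral_mult_left_zero[symmetric]
    by (intro Bochner_Integration.integral_cong refl)
       (simp add: g_def power_mult_distrib scaleR_conv_of_real divide_inverse mult_ac)
  then show "(\<lambda>n. (LINT x|M. p x ^ n / fact n * f x) * z ^ n) sums (LINT x|M. exp (z * p x) * f x)"
    using sums_integral[OF int_g s1 s2] by (simp add: eq)
qed

text \<open>Both sides are entire in \<open>z\<close>, and zeros of a nonzero entire function are
  isolated, so agreement on a segment of the imaginary axis spreads to the plane. The phases may
  differ because each source carries its own emission time in its phase.\<close>

lemma integral_exp_eq_continuation:
  fixes p q f g :: "'a \<Rightarrow> complex" and a b :: real
  assumes f: "integrable M f" and p: "p \<in> borel_measurable M"
    and pB: "\<And>x. f x \<noteq> 0 \<Longrightarrow> norm (p x) \<le> B"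
    and g: "integrable M g" and q: "q \<in> borel_measurable M"
    and qB: "\<And>x. g x \<noteq> 0 \<Longrightarrow> norm (q x) \<le> B'"
    and "a < b"
    and eq: "\<And>t. a < t \<Longrightarrow> t < b \<Longrightarrow>
        (LINT x|M. exp (\<i> * of_real t * p x) * f x) = (LINT x|M. exp (\<i> * of_real t * q x) * g x)"
  shows "(LINT x|M. exp (z * p x) * f x) = (LINT x|M. exp (z * q x) * g x)"
proof -
  define t where "t = (a + b) / 2"
  define w where "w = \<i> * complex_of_real t"
  \<comment> \<open>recentres the power series at an interior point of the segment\<close>
  define F G where "F x = exp (w * p x) * f x" and "G x = exp (w * q x) * g x" for x
  have F: "integrable M F" and G: "integrable M G"
    unfolding F_def G_def by (rule integral_exp_sums(1)[OF f p pB] integral_exp_sums(1)[OF g q qB]; assumption)+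
  have FB: "F x \<noteq> 0 \<Longrightarrow> norm (p x) \<le> B" and GB: "G x \<noteq> 0 \<Longrightarrow> norm (q x) \<le> B'" for x
    using pB qB by (auto simp: F_def G_def)
  define c where "c n = (LINT x|M. p x ^ n / fact n * F x) - (LINT x|M. q x ^ n / fact n * G x)" for n
  define h where "h u = (LINT x|M. exp (u * p x) * F x) - (LINT x|M. exp (u * q x) * G x)" for u
  have h_sums: "(\<lambda>n. c n * u ^ n) sums h u" for u
    unfolding c_def h_def left_diff_distrib
    by (rule sums_diff[OF integral_exp_sums(2)[OF F p FB] integral_exp_sums(2)[OF G q GB]])
  have shift: "h u = (LINT x|M. exp ((u + w) * p x) * f x) - (LINT x|M. exp ((u + w) * q x) * g x)" for u
    unfolding h_def F_def G_def by (simp add: ring_distribs exp_add mult.assoc)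
  have van: "h (\<i> * of_real s) = 0" if "\<bar>s\<bar> < (b - a) / 2" for s
  proof -
    have "a < s + t \<and> s + t < b" using that \<open>a < b\<close> by (auto simp: t_def abs_less_iff field_simps)
    from eq[OF conjunct1[OF this] conjunct2[OF this]] show ?thesis
      by (simp add: shift w_def ring_distribs)
  qed
  have h0: "h 0 = 0" using van[of 0] \<open>a < b\<close> by simp
  \<comment> \<open>A nonzero \<open>c m\<close> would make the origin an isolated zero of
    \<open>h\<close>, against the zeros along the imaginary segment. \<open>powser_0_nonzero\<close>
    asks for \<open>m > 0\<close>, so the constant term is settled separately.\<close>
  have "c m = 0" if "m > 0" for m
  proof (rule ccontr)
    assume "c m \<noteq> 0"
    from powser_0_nonzero[of 1 0 c h m] h_sums h0 this that
    obtain r where r: "r > 0" "\<And>u. u \<in> cball 0 r - {0} \<Longrightarrow> h u \<noteq> 0" by auto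
    define s where "s = min r ((b - a) / 4)"
    have "s > 0" "s \<le> r" "\<bar>s\<bar> < (b - a) / 2" using r(1) \<open>a < b\<close> by (auto simp: s_def min_def)
    moreover from this have "h (\<i> * of_real s) \<noteq> 0" by (intro r(2)) (auto simp: norm_mult)
    ultimately show False using van by blast
  qed
  moreover have "c 0 = 0"
    using h0 sums_unique2[OF h_sums[of 0] powser_sums_zero[of c]] by simp
  ultimately have "c n = 0" for n by (cases n) auto
  then have "h (z - w) = 0" using h_sums[of "z - w"] sums_unique2[OF _ sums_zero] by auto
  then show ?thesis by (simp add: shift)
qed

section \<open>Uniqueness for the Fourier transform of compactly supported functions\<close>

text \<open>Unnormalised, so that the value at 0 is the plain integral; the sign is that of the
  far-field kernel.\<close>

definition fourier :: "('a::euclidean_space \<Rightarrow> real) \<Rightarrow> 'a \<Rightarrow> complex" where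
  "fourier f \<xi> = (LINT y|lborel. exp (- (\<i> * of_real (\<xi> \<bullet> y))) * of_real (f y))"

lemma integrable_exp_mult:
  assumes "integrable lborel f"
  shows "integrable lborel (\<lambda>y. exp (- (\<i> * of_real (\<xi> \<bullet> y))) * complex_of_real (f y))"
proof (rule Bochner_Integration.integrable_bound[OF assms])
  have [measurable]: "f \<in> borel_measurable borel" using assms by auto
  show "(\<lambda>y. exp (- (\<i> * of_real (\<xi> \<bullet> y))) * complex_of_real (f y)) \<in> borel_measurable lborel"
    by (auto intro!: borel_measurable_times borel_measurable_continuous_onI continuous_intros)
qed (simp add: norm_mult)

lemma fourier_add:
  assumes "integrable lborel f" "integrable lborel g"
  shows "fourier (\<lambda>x. f x + g x) \<xi> = fourier f \<xi> + fourier g \<xi>"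
  using assms by (simp add: fourier_def ring_distribs integrable_exp_mult)

lemma fourier_diff:
  assumes "integrable lborel f" "integrable lborel g"
  shows "fourier (\<lambda>x. f x - g x) \<xi> = fourier f \<xi> - fourier g \<xi>"
  using assms by (simp add: fourier_def ring_distribs integrable_exp_mult)

lemma fourier_mult_left: "fourier (\<lambda>x. a * f x) \<xi> = of_real a * fourier f \<xi>"
  unfolding fourier_def integral_mult_right_zero[symmetric]
  by (intro Bochner_Integration.integral_cong) (auto simp: mult_ac)

text \<open>The cosine is the mean of two characters, and multiplying by a character translates the
  transform. Cosines keep the functions real; without the offset \<open>a\<close> they would be even
  and could not separate \<open>x\<close> from \<open>- x\<close>.\<close>

lemma fourier_mult_cos:
  assumes "integrable lborel f"
  shows "fourier (\<lambda>x. cos (\<eta> \<bullet> x + a) * f x) \<xi> =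
    (exp (\<i> * of_real a) * fourier f (\<xi> - \<eta>) + exp (- (\<i> * of_real a)) * fourier f (\<xi> + \<eta>)) / 2"
proof -
  have "exp (- (\<i> * of_real (\<xi> \<bullet> y))) * of_real (cos (\<eta> \<bullet> y + a) * f y) =
     (exp (\<i> * of_real a) * (exp (- (\<i> * of_real ((\<xi> - \<eta>) \<bullet> y))) * of_real (f y)) +
      exp (- (\<i> * of_real a)) * (exp (- (\<i> * of_real ((\<xi> + \<eta>) \<bullet> y))) * of_real (f y))) / 2" for y
    unfolding of_real_mult cos_of_real[symmetric] cos_exp_eq
    by (simp add: inner_simps ring_distribs exp_add exp_diff exp_minus field_simps)
  then show ?thesis
    unfolding fourier_def using assms by (simp only: integrable_exp_mult Bochner_Integration.integral_add
      integral_divide_zero integral_mult_right_zero integrable_mult_right)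
qed

lemma integrable_continuous_mult:
  fixes f g :: "'a::euclidean_space \<Rightarrow> real"
  assumes "compact K" and f: "integrable lborel f" and 0: "\<And>x. x \<notin> K \<Longrightarrow> f x = 0"
    and g: "continuous_on UNIV g"
  shows "integrable lborel (\<lambda>x. g x * f x)"
proof -
  have "bounded (g ` K)"
    using assms by (intro compact_imp_bounded compact_continuous_image)
      (auto intro: continuous_on_subset)
  then obtain B where B: "\<And>x. x \<in> K \<Longrightarrow> \<bar>g x\<bar> \<le> B" by (auto simp: bounded_iff)
  have [measurable]: "f \<in> borel_measurable borel" using f by auto
  have [measurable]: "g \<in> borel_measurable borel" by (rule borel_measurable_continuous_onI[OF g])
  show ?thesis
  proof (rule Bochner_Integration.integrable_bound)
    show "integrable lborel (\<lambda>x. \<bar>B\<bar> * f x)" using f by simp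
    have "\<bar>g x\<bar> * \<bar>f x\<bar> \<le> \<bar>B\<bar> * \<bar>f x\<bar>" for x
      using B[of x] 0[of x] by (cases "x \<in> K") (auto intro!: mult_right_mono)
    then show "AE x in lborel. norm (g x * f x) \<le> norm (\<bar>B\<bar> * f x)" by (simp add: abs_mult)
  qed simp
qed

lemma fourier_zero_imp_integral_zero:
  fixes f :: "'a::euclidean_space \<Rightarrow> real"
  assumes K: "compact K" and f: "integrable lborel f" and f0: "\<And>x. x \<notin> K \<Longrightarrow> f x = 0"
    and van: "\<And>\<xi>. fourier f \<xi> = 0" and g: "continuous_on UNIV g"
  shows "(LINT x|lborel. g x * f x) = 0"
proof -
  text \<open>
    Multiplication by \<open>cos (\<eta> \<bullet> x + a)\<close> combines two translates of the Fourier transform, so it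
    preserves the space \<open>N\<close> of functions with vanishing transform.  The multipliers
    of \<open>N\<close> form a ring by construction, so Stone-Weierstrass applies to them directly.
  \<close>
  define N where "N = {\<phi>::'a \<Rightarrow> real. integrable lborel \<phi> \<and> (\<forall>x. x \<notin> K \<longrightarrow> \<phi> x = 0) \<and> (\<forall>\<xi>. fourier \<phi> \<xi> = 0)}"
  define R where "R = {h::'a \<Rightarrow> real. continuous_on UNIV h \<and> (\<forall>\<phi>\<in>N. (\<lambda>x. h x * \<phi> x) \<in> N)}"
  have cos_R: "(\<lambda>x. cos (\<eta> \<bullet> x + a)) \<in> R" for \<eta> a
    unfolding R_def
  proof (intro CollectI conjI ballI)
    show c: "continuous_on UNIV (\<lambda>x. cos (\<eta> \<bullet> x + a))" by (intro continuous_intros)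
    fix \<phi> assume "\<phi> \<in> N"
    then show "(\<lambda>x. cos (\<eta> \<bullet> x + a) * \<phi> x) \<in> N"
      using integrable_continuous_mult[OF K _ _ c, of \<phi>] by (auto simp: N_def fourier_mult_cos)
  qed
  interpret function_ring_on R K
  proof
    show "\<exists>h\<in>R. h x \<noteq> h y" if "x \<noteq> y" for x y
    proof -
      \<comment> \<open>Scaled so that \<open>\<eta> \<bullet> x - \<eta> \<bullet> y = 1\<close>;
        with offset \<open>- (\<eta> \<bullet> y)\<close> the cosine is \<open>cos 1\<close> at
        \<open>x\<close> and \<open>cos 0\<close> at \<open>y\<close>.\<close>
      define \<eta> where "\<eta> = (x - y) /\<^sub>R (norm (x - y))\<^sup>2"
      have "\<eta> \<bullet> x - \<eta> \<bullet> y = 1"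
        using that unfolding inner_diff_right[symmetric] by (simp add: \<eta>_def dot_square_norm)
      then have "cos (\<eta> \<bullet> x + - (\<eta> \<bullet> y)) = cos 1" by simp
      moreover have "cos (1::real) < cos 0" by (rule cos_monotone_0_pi) (use pi_gt3 in auto)
      ultimately show ?thesis by (intro bexI[OF _ cos_R[of \<eta> "- (\<eta> \<bullet> y)"]]) auto
    qed
    show "(\<lambda>x. h x + k x) \<in> R" if "h \<in> R" "k \<in> R" for h k
      using that by (auto simp: R_def N_def ring_distribs fourier_add intro!: continuous_intros)
    show "(\<lambda>x. h x * k x) \<in> R" if "h \<in> R" "k \<in> R" for h k
      using that by (auto simp: R_def mult.assoc intro!: continuous_intros)
    show "(\<lambda>_. c) \<in> R" for c
      by (auto simp: R_def N_def fourier_mult_left)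
  qed (use K in \<open>auto simp: R_def intro: continuous_on_subset\<close>)
  have R0: "(LINT x|lborel. h x * f x) = 0" if "h \<in> R" for h
  proof -
    \<comment> \<open>At frequency 0 the kernel is 1, so membership in \<open>N\<close> already
      makes the integral vanish.\<close>
    have "fourier (\<lambda>x. h x * f x) 0 = 0"
      using that f f0 van by (auto simp: R_def N_def)
    then show ?thesis by (simp add: fourier_def flip: of_real_mult)
  qed
  have "\<bar>LINT x|lborel. g x * f x\<bar> \<le> e * (LINT x|lborel. \<bar>f x\<bar>)" if "e > 0" for e
  proof -
    obtain h where h: "h \<in> R" "\<And>x. x \<in> K \<Longrightarrow> \<bar>g x - h x\<bar> < e"
      using Stone_Weierstrass_basic[OF continuous_on_subset[OF g] \<open>e > 0\<close>] by blast
    have hc: "continuous_on UNIV h" using h(1) by (simp add: R_def)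
    have "(LINT x|lborel. g x * f x) = (LINT x|lborel. (g x - h x) * f x)"
      using R0[OF h(1)] integrable_continuous_mult[OF K f f0 g] integrable_continuous_mult[OF K f f0 hc]
      by (simp add: left_diff_distrib)
    also have "\<bar>\<dots>\<bar> \<le> (LINT x|lborel. \<bar>(g x - h x) * f x\<bar>)" by (rule integral_abs_bound)
    also have "\<dots> \<le> (LINT x|lborel. e * \<bar>f x\<bar>)"
    proof (rule integral_mono)
      show "integrable lborel (\<lambda>x. \<bar>(g x - h x) * f x\<bar>)"
        by (intro integrable_abs integrable_continuous_mult[OF K f f0] continuous_intros g hc)
      show "\<bar>(g x - h x) * f x\<bar> \<le> e * \<bar>f x\<bar>" for x
        using h(2)[of x] f0[of x] by (cases "x \<in> K") (auto simp: abs_mult intro!: mult_right_mono)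
    qed (use f in simp)
    finally show ?thesis by simp
  qed
  note le = this
  show ?thesis
  proof (rule ccontr)
    define I where "I = \<bar>LINT x|lborel. g x * f x\<bar>"
    define J where "J = (LINT x|lborel. \<bar>f x\<bar>)"
    assume "(LINT x|lborel. g x * f x) \<noteq> 0"
    then have "I > 0" by (simp add: I_def)
    have "J \<ge> 0" by (simp add: J_def)
    \<comment> \<open>\<open>e\<close> is chosen to make \<open>e * J\<close> smaller than
      \<open>I\<close>; the \<open>+ 1\<close> keeps the denominator positive when
      \<open>J = 0\<close>.\<close>
    have "I \<le> I / (2 * (J + 1)) * J"
      using le[of "I / (2 * (J + 1))"] \<open>I > 0\<close> \<open>J \<ge> 0\<close> unfolding I_def[symmetric] J_def[symmetric] by simp
    also have "\<dots> < I"
      using \<open>I > 0\<close> \<open>J \<ge> 0\<close> by (simp add: field_simps add_nonneg_pos)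
    finally show False by simp
  qed
qed

text \<open>If \<open>f p\<close> were nonzero, \<open>f\<close> would keep its sign on a ball
  around \<open>p\<close>. A signed tent function on that ball gives a nonnegative product with
  integral zero, yet positive on a set of positive measure. Continuity is asked at \<open>p\<close>
  alone because extended profiles may jump at the boundary of the domain.\<close>

lemma fourier_zero_imp_zero_at:
  fixes f :: "'a::euclidean_space \<Rightarrow> real"
  assumes K: "compact K" and f: "integrable lborel f" and f0: "\<And>x. x \<notin> K \<Longrightarrow> f x = 0"
    and van: "\<And>\<xi>. fourier f \<xi> = 0" and cont: "isCont f p"
  shows "f p = 0"
proof (rule ccontr)
  assume nz: "f p \<noteq> 0"
  define s where "s = sgn (f p)"
  have "isCont (\<lambda>x. s * f x) p" using cont by (intro continuous_intros)
  moreover have "s * f p > 0" using nz by (simp add: s_def sgn_if)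
  ultimately have "eventually (\<lambda>x. s * f x > 0) (nhds p)"
    using order_tendstoD(1)[of "\<lambda>x. s * f x" "s * f p" "nhds p" 0]
    by (simp add: isCont_def tendsto_at_iff_tendsto_nhds[of "\<lambda>x. s * f x" p])
  then obtain r where r: "r > 0" "\<And>x. dist x p < r \<Longrightarrow> s * f x > 0"
    by (auto simp: eventually_nhds_metric)
  define g where "g x = s * max 0 (r - dist x p)" for x
  have g: "continuous_on UNIV g" unfolding g_def by (intro continuous_intros)
  have nonneg: "g x * f x \<ge> 0" for x
    using r(2)[of x] mult_nonneg_nonneg[of "r - dist x p" "s * f x"]
    by (cases "dist x p < r") (auto simp: g_def mult_ac)
  have "AE x in lborel. g x * f x = 0"
    using fourier_zero_imp_integral_zero[OF K f f0 van g]
      integral_nonneg_eq_0_iff_AE[OF integrable_continuous_mult[OF K f f0 g]] nonneg by auto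
  then have "AE x in lborel. x \<notin> ball p r"
  proof eventually_elim
    case (elim x)
    show ?case using elim r(2)[of x] by (auto simp: g_def dist_commute)
  qed
  then have "emeasure lborel (ball p r) = 0"
    by (subst (asm) AE_iff_measurable[of "ball p r"]) auto
  then show False using r(1) unit_ball_vol_pos[of "real DIM('a)"] by (simp add: emeasure_ball)
qed


section \<open>Zero-extended profiles and the sets that carry them\<close>

definition profile :: "'a set \<Rightarrow> ('a \<Rightarrow> real) \<Rightarrow> 'a \<Rightarrow> real" where
  "profile D S y = indicator D y * S y"

lemma profile_simps [simp]: "y \<in> D \<Longrightarrow> profile D S y = S y" "y \<notin> D \<Longrightarrow> profile D S y = 0"
  by (simp_all add: profile_def)

text \<open>The fifth fact is the support condition made local: nonzero points of \<open>S\<close>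
  are dense in \<open>closure D\<close>, so one lies in the open set \<open>U \<inter> D\<close>.
  Integrability comes from continuity on the compact closure.\<close>

lemma admissible_sourceD:
  assumes "admissible_source D S t0"
  shows "open D" "D \<noteq> {}" "bounded D" "continuous_on D S"
    "\<And>U. open U \<Longrightarrow> U \<inter> D \<noteq> {} \<Longrightarrow> \<exists>x\<in>U \<inter> D. S x \<noteq> 0"
    "integrable lborel (profile D S)"
proof -
  note a = assms[unfolded admissible_source_def lipschitz_domain_def]
  show oD: "open D" and "D \<noteq> {}" and bD: "bounded D" using a by auto
  have cS: "continuous_on (closure D) S" using a by auto
  then show "continuous_on D S" by (rule continuous_on_subset[OF _ closure_subset])
  show "\<exists>x\<in>U \<inter> D. S x \<noteq> 0" if "open U" "U \<inter> D \<noteq> {}" for U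
  proof -
    have "closure {x \<in> closure D. S x \<noteq> 0} = closure D" using a by auto
    then have "U \<inter> D \<inter> closure {x \<in> closure D. S x \<noteq> 0} \<noteq> {}"
      using that(2) closure_subset[of D] by auto
    then show ?thesis
      using open_Int_closure_eq_empty[OF open_Int[OF that(1) oD]] by blast
  qed
  have "integrable lborel (\<lambda>x. indicator D x *\<^sub>R (indicator (closure D) x *\<^sub>R S x))"
    using oD bD cS by (intro integrable_mult_indicator borel_integrable_compact) auto
  also have "(\<lambda>x. indicator D x *\<^sub>R (indicator (closure D) x *\<^sub>R S x)) = profile D S"
    using closure_subset[of D] by (auto simp: fun_eq_iff profile_def indicator_def)
  finally show "integrable lborel (profile D S)" .
qed

text \<open>If \<open>D\<close> left \<open>C\<close>, some \<open>p\<close> in the open set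
  \<open>D - C\<close> would have \<open>S p \<noteq> 0\<close>. Near \<open>p\<close> the
  difference of the two functions is \<open>S\<close>, hence continuous, and Fourier uniqueness
  makes it vanish at \<open>p\<close>. Besides a second profile, \<open>g\<close> may be zero with
  \<open>C\<close> empty, which shows that a source has a nonzero transform.\<close>

lemma fourier_profile_eq_imp_subset:
  assumes D: "admissible_source D S t0"
    and g: "integrable lborel g" and C: "compact C" and g0: "\<And>x. x \<notin> C \<Longrightarrow> g x = 0"
    and eq: "\<And>\<xi>. fourier (profile D S) \<xi> = fourier g \<xi>"
  shows "D \<subseteq> C"
proof (rule ccontr)
  note d = admissible_sourceD[OF D]
  assume "\<not> D \<subseteq> C"
  then obtain p where p: "p \<in> D" "p \<notin> C" "S p \<noteq> 0"
    using d(5)[of "- C"] compact_imp_closed[OF C] by (auto simp: open_Compl)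
  define U where "U = D - C"
  have U: "open U" "p \<in> U" using d(1) compact_imp_closed[OF C] p by (auto simp: U_def)
  define f where "f x = profile D S x - g x" for x
  have fS: "f x = S x" if "x \<in> U" for x using that g0 by (auto simp: U_def f_def)
  have "continuous_on U S" using d(4) by (rule continuous_on_subset) (auto simp: U_def)
  then have "continuous_on U f" by (simp add: fS cong: continuous_on_cong)
  then have "isCont f p" using U continuous_on_eq_continuous_at by blast
  have "f p = 0"
  proof (rule fourier_zero_imp_zero_at[where f=f and p=p and K="closure D \<union> C"])
    show "compact (closure D \<union> C)" using d(3) C by (intro compact_Un) auto
    show "integrable lborel f" unfolding f_def using d(6) g by simp
    show "f x = 0" if "x \<notin> closure D \<union> C" for x
      using that g0[of x] closure_subset[of D] by (auto simp: f_def profile_def indicator_def)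
    show "fourier f \<xi> = 0" for \<xi> unfolding f_def using eq d(6) g by (simp add: fourier_diff)
  qed fact
  with p(3) fS[OF U(2)] show False by simp
qed

section \<open>The far field as a function of frequency\<close>

lemma far_field_eq_fourier:
  "far_field c D S t0 x \<omega> = of_real (1 / sqrt (2 * pi)) *
     (exp (\<i> * of_real (\<omega> * t0)) * fourier (profile D S) ((\<omega> / c) *\<^sub>R x))"
proof -
  have "exp (- (\<i> * complex_of_real (\<omega> * (inverse c * (x \<bullet> y) - t0)))) =
      exp (\<i> * of_real (\<omega> * t0)) * exp (- (\<i> * of_real ((\<omega> / c) *\<^sub>R x \<bullet> y)))" for y
    by (simp add: divide_inverse algebra_simps flip: exp_add)
  then show ?thesis
    unfolding far_field_def set_lebesgue_integral_def fourier_def integral_mult_right_zero[symmetric]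
    by (intro arg_cong2[where f="(*)"] refl Bochner_Integration.integral_cong)
       (simp_all add: profile_def scaleR_conv_of_real[where 'a=complex])
qed

text \<open>Here the emission time stays in the exponent, which becomes
  \<open>\<i> * \<omega>\<close> times a real phase bounded on a bounded \<open>D\<close>: the form
  that continuation in the frequency takes.\<close>

lemma far_field_eq_integral_exp:
  "far_field c D S t0 x \<omega> = of_real (1 / sqrt (2 * pi)) *
     (LINT y|lborel. exp (\<i> * of_real \<omega> * of_real (t0 - inverse c * (x \<bullet> y))) * of_real (profile D S y))"
proof -
  have "- (\<i> * complex_of_real (\<omega> * (inverse c * (x \<bullet> y) - t0))) =
      \<i> * of_real \<omega> * of_real (t0 - inverse c * (x \<bullet> y))" for y
    by (simp add: right_diff_distrib)
  then show ?thesis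
    by (simp only: far_field_def set_lebesgue_integral_def profile_def
        scaleR_conv_of_real[where 'a=complex] of_real_mult mult_ac)
qed

lemma phase_bounded:
  fixes x :: "'a::real_inner"
  assumes "bounded D"
  obtains B where
    "\<And>y. complex_of_real (profile D S y) \<noteq> 0 \<Longrightarrow> norm (complex_of_real (t - k * (x \<bullet> y))) \<le> B"
proof -
  from assms obtain R where R: "\<And>y. y \<in> D \<Longrightarrow> norm y \<le> R" by (auto simp: bounded_iff)
  have "\<bar>t - k * (x \<bullet> y)\<bar> \<le> \<bar>t\<bar> + \<bar>k\<bar> * (norm x * R)" if "y \<in> D" for y
  proof -
    have "\<bar>x \<bullet> y\<bar> \<le> norm x * R"
      using Cauchy_Schwarz_ineq2[of x y] mult_left_mono[OF R[OF that] norm_ge_zero[of x]] by linarith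
    then have "\<bar>k * (x \<bullet> y)\<bar> \<le> \<bar>k\<bar> * (norm x * R)" by (simp add: abs_mult mult_left_mono)
    then show ?thesis by linarith
  qed
  then show ?thesis
    by (intro that[of "\<bar>t\<bar> + \<bar>k\<bar> * (norm x * R)"]) (auto simp: profile_def indicator_def simp del: of_real_diff of_real_mult split: if_splits)
qed

lemma phase_measurable:
  "(\<lambda>y::'a::euclidean_space. complex_of_real (t - k * (x \<bullet> y))) \<in> borel_measurable lborel"
  by (auto intro!: borel_measurable_continuous_onI continuous_intros)

text \<open>The direction is frozen, so this is continuation in the single variable
  \<open>\<omega>\<close>. It reaches the negative frequencies on which the reflection argument for
  the emission times rests.\<close>

lemma far_field_eq_all_frequencies:
  assumes D: "admissible_source D S t0" and D': "admissible_source D' S' t0'"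
    and "a < b"
    and eq: "\<And>\<omega>. a < \<omega> \<Longrightarrow> \<omega> < b \<Longrightarrow> far_field c D S t0 x \<omega> = far_field c D' S' t0' x \<omega>"
  shows "far_field c D S t0 x \<omega> = far_field c D' S' t0' x \<omega>"
proof -
  note d = admissible_sourceD[OF D] and d' = admissible_sourceD[OF D']
  obtain B where B: "\<And>y. complex_of_real (profile D S y) \<noteq> 0 \<Longrightarrow>
      norm (complex_of_real (t0 - inverse c * (x \<bullet> y))) \<le> B"
    using phase_bounded[OF d(3), where x=x] by blast
  obtain B' where B': "\<And>y. complex_of_real (profile D' S' y) \<noteq> 0 \<Longrightarrow>
      norm (complex_of_real (t0' - inverse c * (x \<bullet> y))) \<le> B'"
    using phase_bounded[OF d'(3), where x=x] by blast
  show ?thesis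
    unfolding far_field_eq_integral_exp
    by (rule arg_cong[OF integral_exp_eq_continuation[OF _ phase_measurable B _ phase_measurable B' \<open>a < b\<close>]])
      (use d(6) d'(6) eq in \<open>auto simp: far_field_eq_integral_exp simp del: of_real_diff of_real_mult\<close>)
qed

lemma exp_ii_ne_1:
  assumes "0 < \<bar>\<theta>\<bar>" "\<bar>\<theta>\<bar> < 2 * pi"
  shows "exp (\<i> * complex_of_real \<theta>) \<noteq> 1"
proof
  assume "exp (\<i> * complex_of_real \<theta>) = 1"
  then obtain n :: int where n: "\<theta> = of_int (2 * n) * pi" by (auto simp: exp_eq_1)
  then have "n \<noteq> 0" using assms(1) by auto
  then have "1 * (2 * pi) \<le> \<bar>of_int n\<bar> * (2 * pi)" by (intro mult_right_mono) auto
  also have "\<dots> = \<bar>\<theta>\<bar>" by (simp add: n abs_mult)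
  finally show False using assms(2) by simp
qed

section \<open>Emission times first, then the hulls\<close>

theorem theorem4p6:
  fixes c \<omega>min \<omega>max t0 t0' :: real
    and D D' :: "(real^3) set"
    and S S' :: "real^3 \<Rightarrow> real"
  assumes "c > 0"
    and "\<omega>min < \<omega>max"
    and "admissible_source D S t0"
    and "admissible_source D' S' t0'"
    and "\<And>xhat \<omega>. xhat \<in> sphere 0 1 \<Longrightarrow> \<omega> \<in> {\<omega>min..\<omega>max} \<Longrightarrow>
           far_field c D S t0 xhat \<omega> = far_field c D' S' t0' xhat \<omega>"
  shows "convex hull D = convex hull D' \<and> t0 = t0'"
proof -
  note d = admissible_sourceD[OF assms(3)] and d' = admissible_sourceD[OF assms(4)]
  define F F' where "F = fourier (profile D S)" and "F' = fourier (profile D' S')"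
  have ff: "exp (\<i> * of_real (\<omega> * t0)) * F ((\<omega> / c) *\<^sub>R x) = exp (\<i> * of_real (\<omega> * t0')) * F' ((\<omega> / c) *\<^sub>R x)"
    if x: "norm x = 1" for x \<omega>
  proof -
    have "far_field c D S t0 x \<omega> = far_field c D' S' t0' x \<omega>"
      by (rule far_field_eq_all_frequencies[OF assms(3,4,2)]) (use assms(5) x in auto)
    then show ?thesis by (simp add: far_field_eq_fourier F_def F'_def)
  qed
  have polar: "\<exists>x \<omega>. norm x = 1 \<and> \<xi> = (\<omega> / c) *\<^sub>R x" for \<xi> :: "real^3"
  proof (cases "\<xi> = 0")
    case True
    obtain x :: "real^3" where "norm x = 1" using vector_choose_size[of 1] by auto
    with True show ?thesis by (intro exI[of _ x] exI[of _ 0]) simp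
  next
    case False
    then show ?thesis
      using \<open>c > 0\<close> by (intro exI[of _ "\<xi> /\<^sub>R norm \<xi>"] exI[of _ "c * norm \<xi>"]) simp
  qed
  have t: "t0 = t0'"
  proof (rule ccontr)
    define \<delta> where "\<delta> = t0 - t0'"
    assume "t0 \<noteq> t0'"
    then have \<delta>: "\<bar>\<delta>\<bar> > 0" by (simp add: \<delta>_def)
    \<comment> \<open>The bound \<open>pi / \<bar>\<delta>\<bar>\<close> keeps the angle
      \<open>2 * \<omega> * \<delta>\<close> nonzero and below \<open>2 * pi\<close> in modulus,
      where its exponential cannot be 1.\<close>
    have small: "F ((\<omega> / c) *\<^sub>R x) = 0" if x: "norm x = 1" and \<omega>: "0 < \<omega>" "\<omega> < pi / \<bar>\<delta>\<bar>" for x \<omega>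
    proof (rule ccontr)
      define u where "u = F ((\<omega> / c) *\<^sub>R x)"
      define v where "v = F' ((\<omega> / c) *\<^sub>R x)"
      define e e' where "e = exp (\<i> * complex_of_real (\<omega> * t0))"
        and "e' = exp (\<i> * complex_of_real (\<omega> * t0'))"
      have [simp]: "e \<noteq> 0" "e' \<noteq> 0" by (auto simp: e_def e'_def)
      assume "F ((\<omega> / c) *\<^sub>R x) \<noteq> 0"
      then have u: "u \<noteq> 0" by (simp add: u_def)
      have 1: "e * u = e' * v" using ff[OF x, of \<omega>] by (simp only: e_def e'_def u_def v_def)
      \<comment> \<open>Negating both direction and frequency keeps the point
        \<open>(\<omega> / c) *\<^sub>R x\<close> and inverts both time phases.\<close>
      have "inverse e * u = inverse e' * v"
        using ff[of "- x" "- \<omega>"] x by (simp add: e_def e'_def u_def v_def exp_minus)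
      then have 2: "e' * u = e * v" by (simp add: field_simps)
      \<comment> \<open>Both sides equal \<open>e * e' * v\<close>.\<close>
      have "e * e * u = e' * e' * u" using 1 2 by algebra
      then have "e * e / (e' * e') = 1" using u by simp
      also have "e * e / (e' * e') = exp (\<i> * complex_of_real (\<omega> * (2 * \<delta>)))"
        by (simp add: e_def e'_def \<delta>_def algebra_simps flip: exp_add exp_diff)
      finally have "exp (\<i> * complex_of_real (\<omega> * (2 * \<delta>))) = 1" .
      moreover have "0 < \<bar>\<omega> * (2 * \<delta>)\<bar>" "\<bar>\<omega> * (2 * \<delta>)\<bar> < 2 * pi"
        using \<omega> \<delta> by (auto simp: abs_mult field_simps)
      ultimately show False using exp_ii_ne_1 by blast
    qed
    have fourier_exp: "F ((\<omega> / c) *\<^sub>R x) =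
        (LINT y|lborel. exp (\<i> * of_real \<omega> * of_real (0 - inverse c * (x \<bullet> y))) * of_real (profile D S y))" for \<omega> x
      unfolding F_def fourier_def
      by (intro Bochner_Integration.integral_cong) (simp_all add: divide_inverse mult_ac)
    \<comment> \<open>So far \<open>F\<close> vanishes only on a punctured ball; continuation in the
      frequency, one direction at a time, carries this to every \<open>\<xi>\<close>.\<close>
    have "F \<xi> = 0" for \<xi>
    proof -
      obtain x \<omega> where x: "norm x = 1" and \<xi>: "\<xi> = (\<omega> / c) *\<^sub>R x" using polar by blast
      obtain B where B: "\<And>y. complex_of_real (profile D S y) \<noteq> 0 \<Longrightarrow>
          norm (complex_of_real (0 - inverse c * (x \<bullet> y))) \<le> B"
        using phase_bounded[OF d(3), where x=x] by blast
      \<comment> \<open>Zero is written as an integral with phase 0 and density 0 to fit the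
        continuation lemma.\<close>
      have "F \<xi> = (LINT y::real^3|lborel. exp (\<i> * of_real \<omega> * 0) * 0)"
        unfolding \<xi> fourier_exp
      proof (rule integral_exp_eq_continuation[where B=B and B'=0 and a=0 and b="pi / \<bar>\<delta>\<bar>"])
        show "(LINT y|lborel. exp (\<i> * of_real s * of_real (0 - inverse c * (x \<bullet> y))) * of_real (profile D S y)) =
            (LINT y::real^3|lborel. exp (\<i> * of_real s * 0) * 0)" if "0 < s" "s < pi / \<bar>\<delta>\<bar>" for s
          using small[OF x that] unfolding fourier_exp by simp
      qed (use \<delta> d(6) B phase_measurable in \<open>simp_all del: of_real_diff of_real_mult diff_0\<close>)
      then show ?thesis by simp
    qed
    then have "D \<subseteq> {}"
      by (intro fourier_profile_eq_imp_subset[OF assms(3), of "\<lambda>_. 0"]) (auto simp: F_def fourier_def)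
    with d(2) show False by simp
  qed
  have FF: "F \<xi> = F' \<xi>" for \<xi>
    using polar[of \<xi>] ff t by auto
  \<comment> \<open>The hull of an open set is open, so it lies in the interior of
    \<open>closure (convex hull B)\<close>; for the open convex set \<open>convex hull B\<close>
    this interior is the set itself.\<close>
  have hull: "convex hull A \<subseteq> convex hull B" if "open A" "open B" "A \<subseteq> closure B" for A B :: "(real^3) set"
  proof -
    have "convex hull A \<subseteq> closure (convex hull B)"
      using that(3) closure_mono[OF hull_subset[of B convex]] by (intro hull_minimal) (auto simp: convex_closure)
    then have "convex hull A \<subseteq> interior (closure (convex hull B))"
      using that(1) by (intro interior_maximal open_convex_hull)
    then show ?thesis
      using that(2) by (simp add: convex_interior_closure interior_open open_convex_hull)
  qed
  have "D \<subseteq> closure D'"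
    using d' closure_subset[of D'] FF
    by (intro fourier_profile_eq_imp_subset[OF assms(3), of "profile D' S'"]) (auto simp: F_def F'_def profile_def indicator_def)
  moreover have "D' \<subseteq> closure D"
    using d closure_subset[of D] FF
    by (intro fourier_profile_eq_imp_subset[OF assms(4), of "profile D S"]) (auto simp: F_def F'_def profile_def indicator_def)
  ultimately show ?thesis using hull d(1) d'(1) t by blast
qed

end
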